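(* Let $6 \leq b \leq c$ be integers. Then $\left|\mathcal{F}(K_{1,b,c})\right| = 1 + b$.
   Context: All graphs are finite, undirected and simple, and are considered up to isomorphism. $K_{1,b,c}$ is the complete tripartite graph with parts of sizes $1,b,c$. A Triangle-Y ($\nabla Y$) move on a graph takes a 3-cycle with vertices $x,y,z$, deletes the edges $xy,yz,zx$, and adds a new vertex $v$ with edges $xv,yv,zv$. A Y-Triangle ($Y\nabla$) move is the inverse operation: for a vertex $v$ of degree three whose neighbours $x,y,z$ are pairwise non-adjacent, delete $v$ and add the edges $xy,yz,zx$. Two graphs are cousins if one is obtained from the other by a sequence of zero or more $\nabla Y$ and $Y\nabla$ moves. The family $\mathcal{F}(G)$ is the set of (isomorphism classes of) cousins of $G$, and $|\mathcal{F}(G)|$ is its size. *)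

theory Defs
  imports "Graph_Theory.Graph_Theory"
begin

text \<open>
  A finite simple undirected graph is a \<^locale>\<open>pair_graph\<close>: a finite loop-free digraph without
  parallel arcs whose arc relation is symmetric, so that the edge \<open>xy\<close> is the pair of arcs
  \<open>(x, y)\<close>, \<open>(y, x)\<close>.
\<close>

definition part3 :: "nat \<Rightarrow> nat \<Rightarrow> nat \<Rightarrow> nat" where
  "part3 a b i = (if i < a then 0 else if i < a + b then 1 else 2)"

definition complete_tripartite :: "nat \<Rightarrow> nat \<Rightarrow> nat \<Rightarrow> nat pair_pre_digraph" where
  "complete_tripartite a b c = \<lparr>
     pverts = {..<a + b + c},
     parcs = {(i, j). i < a + b + c \<and> j < a + b + c \<and> part3 a b i \<noteq> part3 a b j} \<rparr>"

definition nabla_Y :: "'a pair_pre_digraph \<Rightarrow> 'a pair_pre_digraph \<Rightarrow> bool" where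
  "nabla_Y G H \<longleftrightarrow> (\<exists>x y z v.
     (x, y) \<in> parcs G \<and> (y, z) \<in> parcs G \<and> (z, x) \<in> parcs G \<and> v \<notin> pverts G \<and>
     H = \<lparr> pverts = insert v (pverts G),
           parcs = (parcs G - symcl {(x, y), (y, z), (z, x)})
                     \<union> symcl {(x, v), (y, v), (z, v)} \<rparr>)"

definition Y_nabla :: "'a pair_pre_digraph \<Rightarrow> 'a pair_pre_digraph \<Rightarrow> bool" where
  "Y_nabla G H \<longleftrightarrow> (\<exists>v x y z.
     v \<in> pverts G \<and> out_degree (with_proj G) v = 3 \<and> parcs G `` {v} = {x, y, z} \<and>
     (x, y) \<notin> parcs G \<and> (y, z) \<notin> parcs G \<and> (z, x) \<notin> parcs G \<and>
     H = \<lparr> pverts = pverts G - {v},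
           parcs = {e \<in> parcs G. fst e \<noteq> v \<and> snd e \<noteq> v}
                     \<union> symcl {(x, y), (y, z), (z, x)} \<rparr>)"

definition graph_iso :: "'a pair_pre_digraph \<Rightarrow> 'a pair_pre_digraph \<Rightarrow> bool" where
  "graph_iso G H \<longleftrightarrow> digraph_iso (with_proj G) (with_proj H)"

text \<open>
  Isomorphisms count as steps because the moves act on graphs up to isomorphism.
\<close>

definition cousins :: "'a pair_pre_digraph \<Rightarrow> 'a pair_pre_digraph \<Rightarrow> bool" where
  "cousins = (\<lambda>G H. nabla_Y G H \<or> Y_nabla G H \<or> graph_iso G H)\<^sup>*\<^sup>*"

text \<open>
  Vertices are natural numbers: every finite graph has an isomorphic copy over this type, and a
  fresh vertex for \<^const>\<open>nabla_Y\<close> always exists.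
\<close>

definition iso_rel :: "nat pair_pre_digraph rel" where
  "iso_rel = {(G, H). pair_graph G \<and> pair_graph H \<and> graph_iso G H}"

definition family :: "nat pair_pre_digraph \<Rightarrow> nat pair_pre_digraph set set" where
  "family G = {H. cousins G H} // iso_rel"

lemma pair_graph_iff:
  "pair_graph G \<longleftrightarrow> finite (pverts G) \<and> parcs G \<subseteq> pverts G \<times> pverts G \<and> sym (parcs G) \<and> irrefl (parcs G)"
  (is "_ = ?R")
proof
  assume "pair_graph G"
  then interpret pair_graph G .
  show ?R
    using pair_finite_verts arc_fst_in_verts arc_snd_in_verts pair_sym_arcs pair_no_loops
    by (fastforce simp: symmetric_def irrefl_def)
next
  assume R: ?R
  then have "finite (parcs G)"
    by (meson finite_SigmaI finite_subset)
  with R show "pair_graph G"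
    by unfold_locales (auto simp: symmetric_def irrefl_def)
qed

lemma pair_graph_complete_tripartite: "pair_graph (complete_tripartite a b c)"
  by (auto simp: pair_graph_iff complete_tripartite_def sym_def irrefl_def)

lemma pair_graph_nabla_Y:
  assumes "pair_graph G" "nabla_Y G H"
  shows "pair_graph H"
proof -
  from assms obtain x y z v where
    a: "(x, y) \<in> parcs G" "(y, z) \<in> parcs G" "(z, x) \<in> parcs G" and v: "v \<notin> pverts G" and
    H: "H = \<lparr> pverts = insert v (pverts G),
           parcs = (parcs G - symcl {(x, y), (y, z), (z, x)})
                     \<union> symcl {(x, v), (y, v), (z, v)} \<rparr>"
    unfolding nabla_Y_def by blast
  have g: "finite (pverts G)" "parcs G \<subseteq> pverts G \<times> pverts G" "sym (parcs G)" "irrefl (parcs G)"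
    using assms(1) by (auto simp: pair_graph_iff)
  have xyz: "x \<in> pverts G" "y \<in> pverts G" "z \<in> pverts G"
    using a g(2) by blast+
  have "parcs H \<subseteq> pverts H \<times> pverts H"
    using g(2) xyz unfolding H symcl_def by simp blast
  moreover have "sym (parcs H)"
    using g(3) unfolding H symcl_def sym_def by simp blast
  moreover have "irrefl (parcs H)"
    using g(4) v xyz unfolding H symcl_def irrefl_def by auto
  ultimately show ?thesis
    using g(1) by (simp add: pair_graph_iff H)
qed

lemma nabla_Y_imp_Y_nabla:
  assumes G: "pair_graph G" and "nabla_Y G H"
  shows "Y_nabla H G"
proof -
  from assms obtain x y z v where
    a: "(x, y) \<in> parcs G" "(y, z) \<in> parcs G" "(z, x) \<in> parcs G" and v: "v \<notin> pverts G" and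
    H: "H = \<lparr> pverts = insert v (pverts G),
           parcs = (parcs G - symcl {(x, y), (y, z), (z, x)})
                     \<union> symcl {(x, v), (y, v), (z, v)} \<rparr>"
    unfolding nabla_Y_def by blast
  have g: "parcs G \<subseteq> pverts G \<times> pverts G" "sym (parcs G)" "irrefl (parcs G)"
    using G by (auto simp: pair_graph_iff)
  have d: "x \<noteq> y" "y \<noteq> z" "z \<noteq> x" "x \<noteq> v" "y \<noteq> v" "z \<noteq> v"
    using a g v unfolding irrefl_def by blast+
  have nb: "out_arcs (with_proj H) v = {(v, x), (v, y), (v, z)}"
  proof (rule set_eqI)
    fix e
    have "e \<notin> parcs G" if "fst e = v"
      using that g(1) v by (cases e) auto
    then show "e \<in> out_arcs (with_proj H) v \<longleftrightarrow> e \<in> {(v, x), (v, y), (v, z)}"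
      using d by (cases e) (auto simp: out_arcs_def H symcl_def)
  qed
  have "out_degree (with_proj H) v = 3"
    unfolding out_degree_def nb using d by simp
  moreover have "parcs H `` {v} = snd ` out_arcs (with_proj H) v"
    by (force simp: out_arcs_def)
  then have "parcs H `` {v} = {x, y, z}"
    unfolding nb by simp
  moreover have "G = \<lparr> pverts = pverts H - {v},
           parcs = {e \<in> parcs H. fst e \<noteq> v \<and> snd e \<noteq> v}
                     \<union> symcl {(x, y), (y, z), (z, x)} \<rparr>"
  proof (rule pair_pre_digraph.equality)
    have "symcl {(x, y), (y, z), (z, x)} \<subseteq> parcs G"
      using a g(2) by (auto simp: symcl_def dest: symD)
    moreover have "fst e \<noteq> v \<and> snd e \<noteq> v" if "e \<in> parcs G" for e
      using that g(1) v by (cases e) auto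
    moreover have "fst e = v \<or> snd e = v" if "e \<in> symcl {(x, v), (y, v), (z, v)}" for e
      using that unfolding symcl_def by auto
    ultimately show "parcs G = parcs \<lparr> pverts = pverts H - {v},
           parcs = {e \<in> parcs H. fst e \<noteq> v \<and> snd e \<noteq> v}
                     \<union> symcl {(x, y), (y, z), (z, x)} \<rparr>"
      unfolding H pair_pre_digraph.simps by blast
  qed (use v in \<open>auto simp: H\<close>)
  moreover have "v \<in> pverts H" "(x, y) \<notin> parcs H" "(y, z) \<notin> parcs H" "(z, x) \<notin> parcs H"
    using d by (auto simp: H symcl_def)
  ultimately show ?thesis
    unfolding Y_nabla_def by blast
qed

lemma
  assumes G: "pair_graph G" and "Y_nabla G H"
  shows pair_graph_Y_nabla: "pair_graph H"
    and Y_nabla_imp_nabla_Y: "nabla_Y H G"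
proof -
  from assms obtain v x y z where
    v: "v \<in> pverts G" and deg: "out_degree (with_proj G) v = 3" and
    nb: "parcs G `` {v} = {x, y, z}" and
    na: "(x, y) \<notin> parcs G" "(y, z) \<notin> parcs G" "(z, x) \<notin> parcs G" and
    H: "H = \<lparr> pverts = pverts G - {v},
           parcs = {e \<in> parcs G. fst e \<noteq> v \<and> snd e \<noteq> v}
                     \<union> symcl {(x, y), (y, z), (z, x)} \<rparr>"
    unfolding Y_nabla_def by blast
  have g: "finite (pverts G)" "parcs G \<subseteq> pverts G \<times> pverts G" "sym (parcs G)" "irrefl (parcs G)"
    using G by (auto simp: pair_graph_iff)
  have "out_arcs (with_proj G) v = Pair v ` (parcs G `` {v})"
    by (force simp: out_arcs_def)
  then have "out_arcs (with_proj G) v = Pair v ` {x, y, z}"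
    unfolding nb .
  then have "card {x, y, z} = 3"
    using deg by (simp add: out_degree_def card_image inj_on_def del: image_insert)
  then have d: "x \<noteq> y" "y \<noteq> z" "z \<noteq> x"
    by (auto simp: card_insert_if split: if_splits)
  have vn: "\<And>u. (v, u) \<in> parcs G \<longleftrightarrow> u = x \<or> u = y \<or> u = z"
    using nb by blast
  then have nv: "\<And>u. (u, v) \<in> parcs G \<longleftrightarrow> u = x \<or> u = y \<or> u = z"
    using g(3) by (metis symD)
  have dv: "x \<noteq> v" "y \<noteq> v" "z \<noteq> v"
    using vn g(4) by (auto simp: irrefl_def)
  have xyz: "x \<in> pverts G" "y \<in> pverts G" "z \<in> pverts G"
    using vn g(2) by auto
  have na': "(y, x) \<notin> parcs G" "(z, y) \<notin> parcs G" "(x, z) \<notin> parcs G"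
    using na g(3) by (auto dest: symD)
  show "pair_graph H"
    using g d dv xyz by (auto simp: pair_graph_iff H symcl_def irrefl_def sym_def)
  have "G = \<lparr> pverts = insert v (pverts H),
           parcs = (parcs H - symcl {(x, y), (y, z), (z, x)})
                     \<union> symcl {(x, v), (y, v), (z, v)} \<rparr>"
  proof (rule pair_pre_digraph.equality)
    have "e \<in> parcs G \<longleftrightarrow> e \<in> (parcs H - symcl {(x, y), (y, z), (z, x)})
                     \<union> symcl {(x, v), (y, v), (z, v)}" for e
    proof (cases "fst e = v \<or> snd e = v")
      case True
      then show ?thesis
        using vn nv dv by (cases e) (auto simp: H symcl_def)
    next
      case False
      then show ?thesis
        using na na' by (cases e) (auto simp: H symcl_def)
    qed
    then show "parcs G = parcs \<lparr> pverts = insert v (pverts H),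
           parcs = (parcs H - symcl {(x, y), (y, z), (z, x)})
                     \<union> symcl {(x, v), (y, v), (z, v)} \<rparr>"
      unfolding pair_pre_digraph.simps by blast
  qed (use v in \<open>auto simp: H\<close>)
  moreover have "v \<notin> pverts H" "(x, y) \<in> parcs H" "(y, z) \<in> parcs H" "(z, x) \<in> parcs H"
    by (auto simp: H symcl_def)
  ultimately show "nabla_Y H G"
    unfolding nabla_Y_def by blast
qed

lemma equiv_iso_rel: "equiv {G. pair_graph G} iso_rel"
proof (rule equivI)
  show "iso_rel \<subseteq> {G. pair_graph G} \<times> {G. pair_graph G}"
    by (auto simp: iso_rel_def)
  show "refl_on {G. pair_graph G} iso_rel"
  proof (rule refl_onI)
    fix G :: "nat pair_pre_digraph"
    assume "G \<in> {G. pair_graph G}"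
    then interpret pair_graph G by simp
    have "digraph_iso (with_proj G) (with_proj G)"
      unfolding digraph_iso_def pre_digraph.digraph_isomorphism_def
      by (rule exI[of _ "\<lparr>iso_verts = id, iso_arcs = id, iso_head = snd, iso_tail = fst\<rparr>"])
        (auto simp: app_iso_def with_proj_def wf_digraph_wp_iff[unfolded with_proj_def] pair_wf_digraph)
    then show "(G, G) \<in> iso_rel"
      using pair_graph by (simp add: iso_rel_def graph_iso_def)
  qed
  show "sym iso_rel"
    by (rule symI)
      (auto simp: iso_rel_def graph_iso_def wf_digraph_wp_iff pair_digraph.pair_wf_digraph
        pair_graph_def intro: digraph_iso_swap)
  show "trans iso_rel"
    by (rule transI) (auto simp: iso_rel_def graph_iso_def intro: digraph_iso_trans)
qed

end

theory Submission
  imports Defs "HOL-Combinatorics.Transposition"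
begin

text \<open>
  Every triangle of \<open>K\<^sub>1\<^sub>,\<^sub>b\<^sub>,\<^sub>c\<close> contains the hub, and after a triangle-Y move on \<open>hub, x, y\<close> the hub is no
  longer adjacent to \<open>x\<close> and \<open>y\<close>. Hence successive triangle-Y moves use disjoint pairs \<open>x, y\<close>, and the
  graph \<open>T\<^sub>k\<close> obtained after \<open>k \<le> b\<close> of them is unique up to isomorphism. All old vertices keep degree
  greater than three, so a Y-triangle move can only undo one of the earlier moves and leads back to
  \<open>T\<^sub>k\<^sub>-\<^sub>1\<close>. The \<open>1 + b\<close> graphs \<open>T\<^sub>k\<close> have different numbers of vertices.
\<close>

section \<open>Injective images of graphs\<close>

text \<open>The source and target vertex types may differ, so that the model graphs over
  \<open>vtx\<close> can be compared with graphs over any other type.\<close>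

definition map_graph :: "('a \<Rightarrow> 'b) \<Rightarrow> 'a pair_pre_digraph \<Rightarrow> 'b pair_pre_digraph" where
  "map_graph f G = \<lparr> pverts = f ` pverts G, parcs = map_prod f f ` parcs G \<rparr>"

lemma pverts_map_graph [simp]: "pverts (map_graph f G) = f ` pverts G"
  by (simp add: map_graph_def)

lemma parcs_map_graph [simp]: "parcs (map_graph f G) = map_prod f f ` parcs G"
  by (simp add: map_graph_def)

lemma map_graph_comp: "map_graph f (map_graph g G) = map_graph (f \<circ> g) G"
  by (simp add: map_graph_def image_comp map_prod.comp)

lemma map_graph_cong:
  assumes "pair_graph G" "\<And>x. x \<in> pverts G \<Longrightarrow> f x = g x"
  shows "map_graph f G = map_graph g G"
proof -
  have "parcs G \<subseteq> pverts G \<times> pverts G"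
    using assms(1) by (simp add: pair_graph_iff)
  then have "map_prod f f ` parcs G = map_prod g g ` parcs G"
    by (intro image_cong) (auto simp: assms(2))
  moreover have "f ` pverts G = g ` pverts G"
    by (intro image_cong) (auto simp: assms(2))
  ultimately show ?thesis
    by (simp add: map_graph_def)
qed

lemma map_graph_arc_iff:
  assumes "pair_graph G" "inj_on f (pverts G)" "p \<in> pverts G" "q \<in> pverts G"
  shows "(f p, f q) \<in> parcs (map_graph f G) \<longleftrightarrow> (p, q) \<in> parcs G"
proof
  assume "(f p, f q) \<in> parcs (map_graph f G)"
  then obtain p' q' where "(p', q') \<in> parcs G" "f p = f p'" "f q = f q'"
    by auto
  moreover have "p' \<in> pverts G" "q' \<in> pverts G"
    using calculation(1) assms(1) by (auto simp: pair_graph_iff)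
  ultimately show "(p, q) \<in> parcs G"
    using assms(2-4) by (metis inj_onD)
qed force

lemma map_graph_neighbours:
  assumes "pair_graph G" "inj_on f (pverts G)" "p \<in> pverts G"
  shows "parcs (map_graph f G) `` {f p} = f ` (parcs G `` {p})"
proof (intro equalityI subsetI)
  fix w assume w: "w \<in> parcs (map_graph f G) `` {f p}"
  then obtain q where "q \<in> pverts G" "w = f q"
    using assms(1) by (auto simp: pair_graph_iff)
  with w show "w \<in> f ` (parcs G `` {p})"
    using map_graph_arc_iff[OF assms, of q] by auto
qed force

lemma pair_graph_map_graph:
  assumes "pair_graph G" "inj_on f (pverts G)"
  shows "pair_graph (map_graph f G)"
proof -
  have g: "finite (pverts G)" "parcs G \<subseteq> pverts G \<times> pverts G" "sym (parcs G)" "irrefl (parcs G)"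
    using assms(1) by (auto simp: pair_graph_iff)
  have "sym (map_prod f f ` parcs G)"
    using g(3) by (force simp: sym_def)
  moreover have "irrefl (map_prod f f ` parcs G)"
    using g(2,4) assms(2) by (fastforce simp: irrefl_def dest: inj_onD)
  ultimately show ?thesis
    using g(1,2) by (auto simp: pair_graph_iff)
qed

text \<open>An isomorphism in the library sense has separate maps for vertices, arcs, heads and
  tails. Since heads and tails are \<open>snd\<close> and \<open>fst\<close> on both sides, the arc
  map is forced to be \<open>map_prod f f\<close>, and only the vertex map remains.\<close>

lemma graph_iso_iff_map_graph:
  assumes "pair_graph G"
  shows "graph_iso G H \<longleftrightarrow> (\<exists>f. inj_on f (pverts G) \<and> H = map_graph f G)"
proof
  assume "graph_iso G H"
  then obtain hom where
    hom: "pre_digraph.digraph_isomorphism (with_proj G) hom" "with_proj H = app_iso hom (with_proj G)"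
    by (auto simp: graph_iso_def digraph_iso_def)
  define f where "f = iso_verts hom"
  have inj: "inj_on f (pverts G)"
    using hom(1) by (simp add: pre_digraph.digraph_isomorphism_def f_def)
  have H: "pverts H = f ` pverts G" "parcs H = iso_arcs hom ` parcs G"
      "iso_tail hom = fst" "iso_head hom = snd"
    using hom(2) by (auto simp: app_iso_def with_proj_def f_def)
  have "iso_arcs hom e = map_prod f f e" if "e \<in> parcs G" for e
    using that hom(1) H(3,4)
    by (auto simp: pre_digraph.digraph_isomorphism_def f_def with_proj_def prod_eq_iff)
  then have "parcs H = map_prod f f ` parcs G"
    unfolding H(2) by (rule image_cong[OF refl])
  with inj H(1) show "\<exists>f. inj_on f (pverts G) \<and> H = map_graph f G"
    by (auto simp: map_graph_def intro!: exI[of _ f])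
next
  assume "\<exists>f. inj_on f (pverts G) \<and> H = map_graph f G"
  then obtain f where f: "inj_on f (pverts G)" "H = map_graph f G"
    by blast
  have G: "parcs G \<subseteq> pverts G \<times> pverts G"
    using assms by (simp add: pair_graph_iff)
  interpret G: pair_graph G by fact
  have "inj_on (map_prod f f) (parcs G)"
    using map_prod_inj_on[OF f(1) f(1)] G by (rule inj_on_subset)
  with f show "graph_iso G H"
    unfolding graph_iso_def digraph_iso_def pre_digraph.digraph_isomorphism_def
    by (intro exI[of _ "\<lparr>iso_verts = f, iso_arcs = map_prod f f, iso_head = snd, iso_tail = fst\<rparr>"])
      (auto simp: app_iso_def with_proj_def wf_digraph_wp_iff[unfolded with_proj_def]
        G.pair_wf_digraph)
qed

section \<open>The two moves\<close>

text \<open>The triangle is given as a set of vertices: no order of its corners has to be chosen,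
  and an image of the set describes the image triangle.\<close>

definition tri_to_Y :: "'a set \<Rightarrow> 'a \<Rightarrow> 'a pair_pre_digraph \<Rightarrow> 'a pair_pre_digraph" where
  "tri_to_Y S v G = \<lparr> pverts = insert v (pverts G),
     parcs = (parcs G - S \<times> S) \<union> S \<times> {v} \<union> {v} \<times> S \<rparr>"

definition Y_to_tri :: "'a \<Rightarrow> 'a pair_pre_digraph \<Rightarrow> 'a pair_pre_digraph" where
  "Y_to_tri v G = \<lparr> pverts = pverts G - {v},
     parcs = {e \<in> parcs G. fst e \<noteq> v \<and> snd e \<noteq> v}
       \<union> (parcs G `` {v} \<times> parcs G `` {v} - Id) \<rparr>"

lemma symcl_triangle:
  assumes "x \<noteq> y" "y \<noteq> z" "z \<noteq> x"
  shows "symcl {(x, y), (y, z), (z, x)} = {x, y, z} \<times> {x, y, z} - Id"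
  using assms by (auto simp: symcl_def)

lemma nabla_Y_iff_tri_to_Y:
  assumes "pair_graph G"
  shows "nabla_Y G H \<longleftrightarrow>
    (\<exists>S v. card S = 3 \<and> S \<times> S - Id \<subseteq> parcs G \<and> v \<notin> pverts G \<and> H = tri_to_Y S v G)"
    (is "_ \<longleftrightarrow> ?R")
proof -
  have g: "sym (parcs G)" "irrefl (parcs G)"
    using assms by (auto simp: pair_graph_iff)
  have H: "\<lparr> pverts = insert v (pverts G),
           parcs = (parcs G - symcl {(x, y), (y, z), (z, x)}) \<union> symcl {(x, v), (y, v), (z, v)} \<rparr>
         = tri_to_Y {x, y, z} v G" if "x \<noteq> y" "y \<noteq> z" "z \<noteq> x" for x y z v
  proof -
    have "symcl {(x, v), (y, v), (z, v)} = {x, y, z} \<times> {v} \<union> {v} \<times> {x, y, z}"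
      by (auto simp: symcl_def)
    \<comment> \<open>Subtracting the diagonal as well changes nothing, because \<open>G\<close> has
      no loops.\<close>
    moreover have "parcs G - ({x, y, z} \<times> {x, y, z} - Id) = parcs G - {x, y, z} \<times> {x, y, z}"
      using g(2) by (auto simp: irrefl_def)
    ultimately show ?thesis
      unfolding symcl_triangle[OF that] tri_to_Y_def by (simp add: Un_assoc)
  qed
  show ?thesis
  proof
    assume "nabla_Y G H"
    then obtain x y z v where
      a: "(x, y) \<in> parcs G" "(y, z) \<in> parcs G" "(z, x) \<in> parcs G" and v: "v \<notin> pverts G" and
      e: "H = \<lparr> pverts = insert v (pverts G),
           parcs = (parcs G - symcl {(x, y), (y, z), (z, x)}) \<union> symcl {(x, v), (y, v), (z, v)} \<rparr>"
      unfolding nabla_Y_def by blast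
    have d: "x \<noteq> y" "y \<noteq> z" "z \<noteq> x"
      using a g(2) unfolding irrefl_def by blast+
    have "{x, y, z} \<times> {x, y, z} - Id \<subseteq> parcs G"
      using a g(1) by (auto dest: symD)
    moreover have "card {x, y, z} = 3"
      using d by auto
    ultimately show ?R
      using v e H[OF d] by metis
  next
    assume ?R
    then obtain S v where S: "card S = 3" "S \<times> S - Id \<subseteq> parcs G" and v: "v \<notin> pverts G"
      and e: "H = tri_to_Y S v G"
      by blast
    from S(1) obtain x y z where xyz: "S = {x, y, z}" "x \<noteq> y" "y \<noteq> z" "z \<noteq> x"
      by (auto simp: card_3_iff)
    then have "(x, y) \<in> parcs G" "(y, z) \<in> parcs G" "(z, x) \<in> parcs G"
      using S(2) by auto
    then show "nabla_Y G H"
      unfolding nabla_Y_def using v e[unfolded xyz(1), folded H[OF xyz(2-4)]] by blast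
  qed
qed

lemma Y_nabla_imp_Y_to_tri:
  assumes "Y_nabla G H"
  obtains v where "v \<in> pverts G" "card (parcs G `` {v}) = 3" "H = Y_to_tri v G"
proof -
  from assms obtain v x y z where
    v: "v \<in> pverts G" and deg: "out_degree (with_proj G) v = 3" and
    nb: "parcs G `` {v} = {x, y, z}" and
    H: "H = \<lparr> pverts = pverts G - {v},
           parcs = {e \<in> parcs G. fst e \<noteq> v \<and> snd e \<noteq> v}
                     \<union> symcl {(x, y), (y, z), (z, x)} \<rparr>"
    unfolding Y_nabla_def by blast
  have "out_arcs (with_proj G) v = Pair v ` (parcs G `` {v})"
    by (force simp: out_arcs_def)
  then have c: "card (parcs G `` {v}) = 3"
    using deg by (simp add: out_degree_def card_image inj_on_def)
  then have d: "x \<noteq> y" "y \<noteq> z" "z \<noteq> x"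
    unfolding nb by (auto simp: card_insert_if split: if_splits)
  have "H = Y_to_tri v G"
    unfolding H Y_to_tri_def nb symcl_triangle[OF d] ..
  with v c that show thesis by blast
qed

text \<open>The delicate point is the set difference; it commutes with the image because
  \<open>map_prod f f\<close> is injective on pairs of vertices. The value \<open>f u\<close> is
  arbitrary, so the image of the new vertex can be prescribed.\<close>

lemma map_graph_tri_to_Y:
  assumes "pair_graph G" "inj_on f (pverts G)" "S \<subseteq> pverts G"
  shows "map_graph f (tri_to_Y S u G) = tri_to_Y (f ` S) (f u) (map_graph f G)"
proof -
  have "parcs G \<subseteq> pverts G \<times> pverts G"
    using assms(1) by (simp add: pair_graph_iff)
  moreover have "inj_on (map_prod f f) (pverts G \<times> pverts G)"
    by (rule map_prod_inj_on[OF assms(2) assms(2)])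
  ultimately have "map_prod f f ` (parcs G - S \<times> S) = map_prod f f ` parcs G - map_prod f f ` (S \<times> S)"
    using assms(3) by (intro inj_on_image_set_diff) auto
  moreover have "map_prod f f ` (A \<times> B) = f ` A \<times> f ` B" for A B
    by (rule map_prod_surj_on[OF refl refl])
  ultimately show ?thesis
    by (simp add: map_graph_def tri_to_Y_def image_Un)
qed

lemma map_graph_Y_to_tri:
  assumes "pair_graph G" "inj_on f (pverts G)" "v \<in> pverts G"
  shows "map_graph f (Y_to_tri v G) = Y_to_tri (f v) (map_graph f G)"
proof -
  let ?N = "parcs G `` {v}"
  have g: "parcs G \<subseteq> pverts G \<times> pverts G"
    using assms(1) by (simp add: pair_graph_iff)
  have N: "?N \<subseteq> pverts G"
    using g by auto
  have "f ` (pverts G - {v}) = f ` pverts G - {f v}"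
    using inj_on_image_set_diff[OF assms(2), of "pverts G" "{v}"] assms(3) by simp
  moreover have "map_prod f f ` {e \<in> parcs G. fst e \<noteq> v \<and> snd e \<noteq> v}
      = {e \<in> map_prod f f ` parcs G. fst e \<noteq> f v \<and> snd e \<noteq> f v}"
    using g assms(2,3) by (fastforce dest: inj_onD)
  moreover have "map_prod f f ` (?N \<times> ?N - Id) = f ` ?N \<times> f ` ?N - Id"
    using N assms(2) by (fastforce dest: inj_onD)
  moreover have "(map_prod f f ` parcs G) `` {f v} = f ` ?N"
    using map_graph_neighbours[OF assms] by simp
  ultimately show ?thesis
    by (simp add: map_graph_def Y_to_tri_def image_Un)
qed

section \<open>The graphs obtained by successive triangle-Y moves\<close>

datatype vtx = Hub | L nat | R nat | S nat

text \<open>\<open>L\<close> and \<open>R\<close> are the parts of sizes \<open>b\<close> and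
  \<open>c\<close>, and indices below \<open>k\<close> are those whose pair has been used by a move.
  Each edge is listed in one orientation; \<open>T\<close> symmetrises and restricts to the vertices
  present.\<close>

fun adj :: "nat \<Rightarrow> vtx \<Rightarrow> vtx \<Rightarrow> bool" where
  "adj k Hub (L i) = (k \<le> i)"
| "adj k Hub (R j) = (k \<le> j)"
| "adj k Hub (S i) = True"
| "adj k (L i) (R j) = (i \<noteq> j \<or> k \<le> i)"
| "adj k (L i) (S j) = (i = j)"
| "adj k (R i) (S j) = (i = j)"
| "adj k _ _ = False"

text \<open>
  \<open>S i\<close> is the vertex introduced by the move on the triangle \<open>Hub, L i, R i\<close>, for \<open>i < k\<close>.
\<close>

definition T :: "nat \<Rightarrow> nat \<Rightarrow> nat \<Rightarrow> vtx pair_pre_digraph" where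
  "T b c k = \<lparr> pverts = insert Hub (L ` {..<b} \<union> R ` {..<c} \<union> S ` {..<k}),
     parcs = {(p, q). {p, q} \<subseteq> insert Hub (L ` {..<b} \<union> R ` {..<c} \<union> S ` {..<k})
       \<and> (adj k p q \<or> adj k q p)} \<rparr>"

lemma in_pverts_T [simp]:
  "Hub \<in> pverts (T b c k)"
  "L i \<in> pverts (T b c k) \<longleftrightarrow> i < b"
  "R i \<in> pverts (T b c k) \<longleftrightarrow> i < c"
  "S i \<in> pverts (T b c k) \<longleftrightarrow> i < k"
  by (auto simp: T_def)

lemma in_parcs_T [simp]:
  "(p, q) \<in> parcs (T b c k) \<longleftrightarrow>
    p \<in> pverts (T b c k) \<and> q \<in> pverts (T b c k) \<and> (adj k p q \<or> adj k q p)"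
  by (auto simp: T_def)

lemma not_adj_refl [simp]: "\<not> adj k p p"
  by (cases p) auto

lemma pair_graph_T: "pair_graph (T b c k)"
proof -
  have "finite (pverts (T b c k))"
    by (simp add: T_def)
  then show ?thesis
    by (auto simp: pair_graph_iff sym_def irrefl_def)
qed

lemma card_pverts_T: "card (pverts (T b c k)) = 1 + b + c + k"
proof -
  have "card (L ` {..<b} \<union> R ` {..<c} \<union> S ` {..<k}) = b + c + k"
    by (subst card_Un_disjoint; (subst card_Un_disjoint)?) (auto simp: card_image inj_on_def)
  moreover have "Hub \<notin> L ` {..<b} \<union> R ` {..<c} \<union> S ` {..<k}"
    by auto
  ultimately show ?thesis
    by (simp add: T_def)
qed

section \<open>Triangles and vertices of degree three in \<open>T b c k\<close>\<close>

text \<open>The neighbours of \<open>S i\<close> are \<open>Hub\<close>, \<open>L i\<close>,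
  \<open>R i\<close>, which are pairwise non-adjacent for \<open>i < k\<close>, so no triangle
  contains \<open>S i\<close>. Two \<open>L\<close> or two \<open>R\<close> vertices are never
  adjacent, which leaves one vertex of each remaining kind, and \<open>Hub\<close> sees only indices
  from \<open>k\<close> on.\<close>

lemma triangle_T:
  assumes "card A = 3" "A \<times> A - Id \<subseteq> parcs (T b c k)"
  obtains i j where "A = {Hub, L i, R j}" "k \<le> i" "i < b" "k \<le> j" "j < c"
proof -
  from assms(1) obtain p q r where A: "A = {p, q, r}" and d: "p \<noteq> q" "q \<noteq> r" "r \<noteq> p"
    by (auto simp: card_3_iff)
  have "(x, y) \<in> parcs (T b c k)" if "x \<in> A" "y \<in> A" "x \<noteq> y" for x y
    using that assms(2) by blast
  then have "(p, q) \<in> parcs (T b c k)" "(q, r) \<in> parcs (T b c k)" "(p, r) \<in> parcs (T b c k)"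
    unfolding A using d by blast+
  then have "\<exists>i j. Hub \<in> {p, q, r} \<and> L i \<in> {p, q, r} \<and> R j \<in> {p, q, r} \<and>
      k \<le> i \<and> i < b \<and> k \<le> j \<and> j < c"
    by (cases p; cases q; cases r) auto
  then obtain i j where ij: "{Hub, L i, R j} \<subseteq> A" "k \<le> i" "i < b" "k \<le> j" "j < c"
    unfolding A by blast
  moreover have "finite A" "card {Hub, L i, R j} = card A"
    using assms(1) A by auto
  ultimately have "A = {Hub, L i, R j}"
    using card_subset_eq by blast
  with ij that show thesis by blast
qed

text \<open>Every vertex other than an \<open>S i\<close> keeps at least four neighbours: each used
  pair costs \<open>Hub\<close> one \<open>R\<close> neighbour but gives it an \<open>S\<close>
  neighbour, and \<open>L i\<close> or \<open>R i\<close> loses at most the edge to its partner in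
  the opposite part.\<close>

lemma degree_three_T:
  assumes "p \<in> pverts (T b c k)" "card (parcs (T b c k) `` {p}) = 3" "5 \<le> b" "5 \<le> c" "k \<le> c"
  obtains i where "p = S i" "i < k"
proof -
  let ?N = "parcs (T b c k) `` {p}"
  have fin: "finite ?N"
    using assms(2) card.infinite by fastforce
  have big: False if "M \<subseteq> ?N" "4 \<le> card M" for M
    using card_mono[OF fin that(1)] that(2) assms(2) by simp
  show thesis
  proof (cases p)
    case Hub
    have "card (R ` {k..<c} \<union> S ` {..<k}) = c"
      using assms(5) by (subst card_Un_disjoint) (auto simp: card_image inj_on_def)
    then have "4 \<le> card (R ` {k..<c} \<union> S ` {..<k})"
      using assms(4) by simp
    moreover have "R ` {k..<c} \<union> S ` {..<k} \<subseteq> ?N"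
      using Hub by auto
    ultimately show thesis
      using big by blast
  next
    case (L i)
    have "card (R ` ({..<c} - {i})) \<ge> 4"
      using assms(4) by (auto simp: card_image inj_on_def card_Diff_singleton_if)
    moreover have "R ` ({..<c} - {i}) \<subseteq> ?N"
      using L assms(1) by auto
    ultimately show thesis
      using big by blast
  next
    case (R i)
    have "card (L ` ({..<b} - {i})) \<ge> 4"
      using assms(3) by (auto simp: card_image inj_on_def card_Diff_singleton_if)
    moreover have "L ` ({..<b} - {i}) \<subseteq> ?N"
      using R assms(1) by auto
    ultimately show thesis
      using big by blast
  next
    case (S i)
    then show thesis
      using that assms(1) by simp
  qed
qed

text \<open>Raising \<open>k\<close> by one changes the conditions in \<open>adj\<close> only at
  index \<open>k\<close>, which removes exactly the edges of this triangle.\<close>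

lemma tri_to_Y_T:
  assumes "k < b" "b \<le> c"
  shows "tri_to_Y {Hub, L k, R k} (S k) (T b c k) = T b c (Suc k)"
proof (rule pair_pre_digraph.equality)
  show "pverts (tri_to_Y {Hub, L k, R k} (S k) (T b c k)) = pverts (T b c (Suc k))"
    by (auto simp: tri_to_Y_def T_def)
  have "(p, q) \<in> parcs (tri_to_Y {Hub, L k, R k} (S k) (T b c k)) \<longleftrightarrow> (p, q) \<in> parcs (T b c (Suc k))"
    for p q
    using assms by (cases p; cases q) (auto simp: tri_to_Y_def)
  then show "parcs (tri_to_Y {Hub, L k, R k} (S k) (T b c k)) = parcs (T b c (Suc k))"
    by auto
qed simp

lemma Y_to_tri_T:
  assumes "k < b" "b \<le> c"
  shows "Y_to_tri (S k) (T b c (Suc k)) = T b c k"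
proof (rule pair_pre_digraph.equality)
  show "pverts (Y_to_tri (S k) (T b c (Suc k))) = pverts (T b c k)"
    by (auto simp: Y_to_tri_def T_def)
  have "(p, q) \<in> parcs (Y_to_tri (S k) (T b c (Suc k))) \<longleftrightarrow> (p, q) \<in> parcs (T b c k)"
    for p q
    using assms by (cases p; cases q) (auto simp: Y_to_tri_def)
  then show "parcs (Y_to_tri (S k) (T b c (Suc k))) = parcs (T b c k)"
    by auto
qed simp

section \<open>Automorphisms of \<open>T b c k\<close> permuting indices\<close>

fun relabel :: "(nat \<Rightarrow> nat) \<Rightarrow> (nat \<Rightarrow> nat) \<Rightarrow> (nat \<Rightarrow> nat) \<Rightarrow> vtx \<Rightarrow> vtx" where
  "relabel \<alpha> \<beta> \<gamma> Hub = Hub"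
| "relabel \<alpha> \<beta> \<gamma> (L i) = L (\<alpha> i)"
| "relabel \<alpha> \<beta> \<gamma> (R i) = R (\<beta> i)"
| "relabel \<alpha> \<beta> \<gamma> (S i) = S (\<gamma> i)"

text \<open>Preservation of arcs in one direction suffices: every arc is the image of its own
  image.\<close>

lemma map_graph_involution:
  assumes "pair_graph G" "\<And>p. \<sigma> (\<sigma> p) = p" "\<And>p. p \<in> pverts G \<Longrightarrow> \<sigma> p \<in> pverts G"
    "\<And>p q. (p, q) \<in> parcs G \<Longrightarrow> (\<sigma> p, \<sigma> q) \<in> parcs G"
  shows "map_graph \<sigma> G = G"
proof (rule pair_pre_digraph.equality)
  show "pverts (map_graph \<sigma> G) = pverts G"
    using assms(2,3) by (auto simp: image_iff) metis
  show "parcs (map_graph \<sigma> G) = parcs G"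
  proof (intro equalityI subsetI)
    fix e assume "e \<in> parcs G"
    then have "map_prod \<sigma> \<sigma> e \<in> parcs G"
      using assms(4) by (cases e) auto
    moreover have "e = map_prod \<sigma> \<sigma> (map_prod \<sigma> \<sigma> e)"
      by (cases e) (simp add: assms(2))
    ultimately show "e \<in> parcs (map_graph \<sigma> G)"
      unfolding parcs_map_graph by (rule rev_image_eqI)
  qed (use assms(4) in auto)
qed simp

lemma involution_relabel_transpose:
  "relabel (transpose i i') (transpose j j') (transpose l l')
     (relabel (transpose i i') (transpose j j') (transpose l l') p) = p"
  by (cases p) auto

text \<open>Among indices from \<open>k\<close> on, the \<open>L\<close> and \<open>R\<close>
  vertices are completely joined and look alike, so both parts can be permuted independently there.
  \<open>transpose 0 0\<close> is the identity on the \<open>S\<close> indices.\<close>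

lemma automorphism_untouched:
  assumes "k \<le> i" "i < b" "k \<le> j" "j < c" "b \<le> c"
  shows "map_graph (relabel (transpose i k) (transpose j k) (transpose 0 0)) (T b c k) = T b c k"
proof (rule map_graph_involution[OF pair_graph_T involution_relabel_transpose])
  let ?\<sigma> = "relabel (transpose i k) (transpose j k) (transpose 0 0)"
  show "?\<sigma> p \<in> pverts (T b c k)" if "p \<in> pverts (T b c k)" for p
    using that assms by (cases p) (auto simp: transpose_def)
  show "(?\<sigma> p, ?\<sigma> q) \<in> parcs (T b c k)" if "(p, q) \<in> parcs (T b c k)" for p q
    using that assms by (cases p; cases q) (auto simp: transpose_def)
qed

text \<open>Used indices can be permuted if \<open>L\<close>, \<open>R\<close> and \<open>S\<close>
  move together, since adjacency then depends only on equality of indices and on which indices are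
  below \<open>Suc k\<close>.\<close>

lemma automorphism_touched:
  assumes "i \<le> k" "k < b" "b \<le> c"
  shows "map_graph (relabel (transpose i k) (transpose i k) (transpose i k)) (T b c (Suc k))
    = T b c (Suc k)"
proof (rule map_graph_involution[OF pair_graph_T involution_relabel_transpose])
  let ?\<sigma> = "relabel (transpose i k) (transpose i k) (transpose i k)"
  show "?\<sigma> p \<in> pverts (T b c (Suc k))" if "p \<in> pverts (T b c (Suc k))" for p
    using that assms by (cases p) (auto simp: transpose_def)
  show "(?\<sigma> p, ?\<sigma> q) \<in> parcs (T b c (Suc k))" if "(p, q) \<in> parcs (T b c (Suc k))" for p q
    using that assms by (cases p; cases q) (auto simp: transpose_def)
qed

section \<open>Isomorphism types of cousins\<close>

text \<open>This is isomorphism to \<open>T b c k\<close>, stated through \<open>map_graph\<close>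
  because \<open>graph_iso\<close> relates only graphs over one vertex type.\<close>

definition shape :: "nat \<Rightarrow> nat \<Rightarrow> nat \<Rightarrow> 'a pair_pre_digraph \<Rightarrow> bool" where
  "shape b c k G \<longleftrightarrow> (\<exists>f. inj_on f (pverts (T b c k)) \<and> G = map_graph f (T b c k))"

lemma shape_pair_graph: "shape b c k G \<Longrightarrow> pair_graph G"
  by (auto simp: shape_def intro: pair_graph_map_graph pair_graph_T)

lemma shape_card_pverts: "shape b c k G \<Longrightarrow> card (pverts G) = 1 + b + c + k"
  by (auto simp: shape_def card_image card_pverts_T)

lemma shape_graph_iso:
  assumes "shape b c k G" "graph_iso G H"
  shows "shape b c k H"
proof -
  from assms(1) obtain f where f: "inj_on f (pverts (T b c k))" "G = map_graph f (T b c k)"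
    by (auto simp: shape_def)
  from assms obtain g where g: "inj_on g (pverts G)" "H = map_graph g G"
    using graph_iso_iff_map_graph[OF shape_pair_graph] by blast
  have "inj_on (g \<circ> f) (pverts (T b c k))" "H = map_graph (g \<circ> f) (T b c k)"
    using f g by (auto simp: map_graph_comp intro: comp_inj_on)
  then show ?thesis
    unfolding shape_def by blast
qed

lemma same_shape_graph_iso:
  assumes "shape b c k G" "shape b c k H"
  shows "graph_iso G H"
proof -
  let ?V = "pverts (T b c k)"
  from assms obtain f g where f: "inj_on f ?V" "G = map_graph f (T b c k)"
    and g: "inj_on g ?V" "H = map_graph g (T b c k)"
    by (auto simp: shape_def)
  let ?h = "g \<circ> inv_into ?V f"
  have "inj_on ?h (pverts G)"
    using f g by (auto intro!: comp_inj_on inj_on_inv_into simp: inv_into_image_cancel)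
  moreover have "map_graph ?h G = H"
    unfolding f(2) g(2) map_graph_comp
    by (rule map_graph_cong[OF pair_graph_T]) (simp add: f(1))
  ultimately show ?thesis
    using graph_iso_iff_map_graph[OF shape_pair_graph[OF assms(1)]] by blast
qed

text \<open>The triangle is pulled back to the model, where \<open>triangle_T\<close> determines its
  form, and an automorphism carries it to \<open>Hub\<close>, \<open>L k\<close>,
  \<open>R k\<close>. For \<open>k = b\<close> there is no triangle left, whence
  \<open>k < b\<close>.\<close>

lemma shape_nabla_Y:
  assumes "shape b c k G" "k \<le> b" "b \<le> c" "nabla_Y G H"
  shows "k < b \<and> shape b c (Suc k) H"
proof -
  let ?T = "T b c k"
  from assms(1) obtain f where f: "inj_on f (pverts ?T)" "G = map_graph f ?T"
    by (auto simp: shape_def)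
  from assms(4) obtain A v where A: "card A = 3" "A \<times> A - Id \<subseteq> parcs G"
    and v: "v \<notin> pverts G" and H: "H = tri_to_Y A v G"
    using nabla_Y_iff_tri_to_Y[OF shape_pair_graph[OF assms(1)]] by blast
  \<comment> \<open>Each corner is the tail of an arc to another corner, hence a vertex of
    \<open>G\<close>.\<close>
  have "A \<subseteq> f ` pverts ?T"
  proof
    fix a assume a: "a \<in> A"
    have "A \<noteq> {a}"
      using A(1) by auto
    then obtain a' where "a' \<in> A" "a' \<noteq> a"
      using a by blast
    with a A(2) have "(a, a') \<in> parcs G"
      by auto
    then show "a \<in> f ` pverts ?T"
      unfolding f(2) by auto
  qed
  then obtain B where B: "B \<subseteq> pverts ?T" "A = f ` B"
    by (auto simp: subset_image_iff)
  have inj_B: "inj_on f B"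
    using f(1) B(1) by (rule inj_on_subset)
  have "card B = 3"
    using A(1) B(2) inj_B by (simp add: card_image)
  moreover have "B \<times> B - Id \<subseteq> parcs ?T"
  proof
    fix e assume "e \<in> B \<times> B - Id"
    then obtain p q where e: "e = (p, q)" and pq: "p \<in> B" "q \<in> B" "p \<noteq> q"
      by auto
    then have "(f p, f q) \<in> parcs G"
      using A(2) B(2) inj_B by (auto dest: inj_onD)
    then show "e \<in> parcs ?T"
      using map_graph_arc_iff[OF pair_graph_T f(1)] pq B(1) unfolding e f(2) by blast
  qed
  ultimately obtain i j where ij: "B = {Hub, L i, R j}" "k \<le> i" "i < b" "k \<le> j" "j < c"
    using triangle_T[of B b c k] by blast
  define \<sigma> where "\<sigma> = relabel (transpose i k) (transpose j k) (transpose 0 0)"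
  have \<sigma>: "map_graph \<sigma> ?T = ?T"
    unfolding \<sigma>_def using ij assms(3) by (intro automorphism_untouched)
  have inj_\<sigma>: "inj \<sigma>"
    unfolding \<sigma>_def by (rule inj_on_inverseI, rule involution_relabel_transpose)
  have \<sigma>_V: "\<sigma> ` pverts ?T = pverts ?T"
    using \<sigma> by (metis pverts_map_graph)
  \<comment> \<open>\<open>S k\<close> is not yet a vertex of \<open>?T\<close>, so redirecting it
    to the new vertex \<open>v\<close> leaves the image of \<open>?T\<close> unchanged.\<close>
  define g where "g = (f \<circ> \<sigma>)(S k := v)"
  have g_V: "g p = f (\<sigma> p)" if "p \<in> pverts ?T" for p
    using that by (auto simp: g_def)
  have inj_f\<sigma>: "inj_on (f \<circ> \<sigma>) (pverts ?T)"
    using f(1) inj_\<sigma> \<sigma>_V by (intro comp_inj_on) (auto intro: inj_on_subset)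
  have inj_g: "inj_on g (pverts ?T)"
    using inj_f\<sigma> by (simp add: inj_on_def g_V)
  have G: "G = map_graph g ?T"
  proof -
    have "G = map_graph (f \<circ> \<sigma>) ?T"
      using f(2) \<sigma> by (metis map_graph_comp)
    also have "\<dots> = map_graph g ?T"
      by (rule map_graph_cong[OF pair_graph_T]) (simp add: g_V)
    finally show ?thesis .
  qed
  have k: "k < b"
    using ij by simp
  have "g ` {Hub, L k, R k} = A"
    using ij B k by (simp add: g_def \<sigma>_def)
  moreover have "g (S k) = v"
    by (simp add: g_def)
  ultimately have "H = tri_to_Y (g ` {Hub, L k, R k}) (g (S k)) (map_graph g ?T)"
    using H G by simp
  also have "\<dots> = map_graph g (tri_to_Y {Hub, L k, R k} (S k) ?T)"
    using k assms(3) by (intro map_graph_tri_to_Y[symmetric] pair_graph_T inj_g) auto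
  also have "\<dots> = map_graph g (T b c (Suc k))"
    using k assms(3) by (simp only: tri_to_Y_T)
  finally have "H = map_graph g (T b c (Suc k))" .
  \<comment> \<open>Injectivity survives the additional vertex because \<open>v\<close> is fresh for
    \<open>G\<close>.\<close>
  moreover have "inj_on g (pverts (T b c (Suc k)))"
  proof -
    have "pverts (T b c (Suc k)) = insert (S k) (pverts ?T)"
      by (auto simp: T_def)
    moreover have "g (S k) \<notin> g ` pverts ?T"
      using v G by (simp add: g_def)
    ultimately show ?thesis
      using inj_g by auto
  qed
  ultimately show ?thesis
    using k unfolding shape_def by blast
qed

text \<open>By the degree count the deleted vertex is some \<open>S i\<close>. An automorphism makes
  it the one with the last used index, and removing that one gives the preceding model
  graph.\<close>

lemma shape_Y_nabla:
  assumes "shape b c k G" "k \<le> b" "5 \<le> b" "b \<le> c" "Y_nabla G H"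
  obtains k' where "k = Suc k'" "shape b c k' H"
proof -
  let ?T = "T b c k"
  from assms(1) obtain f where f: "inj_on f (pverts ?T)" "G = map_graph f ?T"
    by (auto simp: shape_def)
  from assms(5) obtain v where v: "v \<in> pverts G" "card (parcs G `` {v}) = 3" "H = Y_to_tri v G"
    by (rule Y_nabla_imp_Y_to_tri)
  from v(1) f(2) obtain p where p: "p \<in> pverts ?T" "v = f p"
    by auto
  have "parcs G `` {v} = f ` (parcs ?T `` {p})"
    unfolding f(2) p(2) by (rule map_graph_neighbours[OF pair_graph_T f(1) p(1)])
  moreover have "inj_on f (parcs ?T `` {p})"
    using f(1) by (rule inj_on_subset) auto
  ultimately have "card (parcs ?T `` {p}) = 3"
    using v(2) by (simp add: card_image)
  then obtain i where i: "p = S i" "i < k"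
    using degree_three_T[OF p(1)] assms(2-4) by auto
  then obtain k' where k: "k = Suc k'" "i \<le> k'"
    by (cases k) auto
  have k': "k' < b"
    using k assms(2) by simp
  define \<sigma> where "\<sigma> = relabel (transpose i k') (transpose i k') (transpose i k')"
  have \<sigma>: "map_graph \<sigma> ?T = ?T"
    unfolding \<sigma>_def k(1) using k(2) k' assms(4) by (intro automorphism_touched)
  have inj_\<sigma>: "inj \<sigma>"
    unfolding \<sigma>_def by (rule inj_on_inverseI, rule involution_relabel_transpose)
  have \<sigma>_V: "\<sigma> ` pverts ?T = pverts ?T"
    using \<sigma> by (metis pverts_map_graph)
  let ?g = "f \<circ> \<sigma>"
  have inj_g: "inj_on ?g (pverts ?T)"
    using f(1) inj_\<sigma> \<sigma>_V by (intro comp_inj_on) (auto intro: inj_on_subset)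
  have G: "G = map_graph ?g ?T"
    using f(2) \<sigma> by (metis map_graph_comp)
  have "v = ?g (S k')"
    using p(2) i by (simp add: \<sigma>_def)
  then have "H = Y_to_tri (?g (S k')) (map_graph ?g ?T)"
    using v(3) G by simp
  also have "\<dots> = map_graph ?g (Y_to_tri (S k') ?T)"
    using k(1) by (intro map_graph_Y_to_tri[symmetric] pair_graph_T inj_g) simp
  also have "\<dots> = map_graph ?g (T b c k')"
    using k' assms(4) unfolding k(1) by (simp only: Y_to_tri_T)
  finally have "H = map_graph ?g (T b c k')" .
  moreover have "inj_on ?g (pverts (T b c k'))"
    using inj_g by (rule inj_on_subset) (auto simp: T_def k(1))
  ultimately show thesis
    using that k(1) unfolding shape_def by blast
qed

section \<open>Determining all cousins of the tripartite graph\<close>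

lemma shape_complete_tripartite: "shape b c 0 (complete_tripartite 1 b c)"
proof -
  \<comment> \<open>The offsets follow the blocks of \<open>part3 1 b\<close>: the hub is 0, then
    \<open>b\<close> numbers for \<open>L\<close>, then those for \<open>R\<close>. The value at
    \<open>S i\<close> is a dummy, as \<open>T b c 0\<close> contains no such vertex.\<close>
  define f where "f p = (case p of Hub \<Rightarrow> 0 | L i \<Rightarrow> 1 + i | R j \<Rightarrow> 1 + b + j | S i \<Rightarrow> 0)" for p
  let ?T = "T b c 0" and ?K = "complete_tripartite 1 b c"
  have V: "pverts ?T = insert Hub (L ` {..<b} \<union> R ` {..<c})"
    by (simp add: T_def)
  have inj: "inj_on f (pverts ?T)"
    unfolding V by (auto simp: inj_on_def f_def)
  have fV: "f ` pverts ?T = pverts ?K"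
  proof (intro equalityI subsetI)
    fix n assume n: "n \<in> pverts ?K"
    consider "n = 0" | "0 < n" "n \<le> b" | "b < n"
      by linarith
    then show "n \<in> f ` pverts ?T"
    proof cases
      case 1
      then show ?thesis
        by (intro image_eqI[of _ _ Hub]) (auto simp: f_def)
    next
      case 2
      then show ?thesis
        by (intro image_eqI[of _ _ "L (n - 1)"]) (auto simp: f_def)
    next
      case 3
      then show ?thesis
        using n by (intro image_eqI[of _ _ "R (n - 1 - b)"]) (auto simp: f_def complete_tripartite_def)
    qed
  qed (auto simp: V f_def complete_tripartite_def)
  have arc: "(f p, f q) \<in> parcs ?K \<longleftrightarrow> (p, q) \<in> parcs ?T"
    if "p \<in> pverts ?T" "q \<in> pverts ?T" for p q
    using that by (cases p; cases q) (auto simp: f_def complete_tripartite_def part3_def)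
  have "?K = map_graph f ?T"
  proof (rule pair_pre_digraph.equality)
    show "parcs ?K = parcs (map_graph f ?T)"
    proof (intro equalityI subsetI)
      fix e assume e: "e \<in> parcs ?K"
      moreover have "parcs ?K \<subseteq> f ` pverts ?T \<times> f ` pverts ?T"
        unfolding fV using pair_graph_complete_tripartite by (simp add: pair_graph_iff)
      ultimately obtain p q where pq: "p \<in> pverts ?T" "q \<in> pverts ?T" "e = (f p, f q)"
        by blast
      with e arc have "(p, q) \<in> parcs ?T"
        by blast
      then show "e \<in> parcs (map_graph f ?T)"
        unfolding parcs_map_graph pq(3) by (rule rev_image_eqI) simp
    next
      fix e assume "e \<in> parcs (map_graph f ?T)"
      then obtain p q where "(p, q) \<in> parcs ?T" "e = (f p, f q)"
        unfolding parcs_map_graph by blast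
      then show "e \<in> parcs ?K"
        using arc in_parcs_T by blast
    qed
  qed (simp_all add: fV)
  with inj show ?thesis
    unfolding shape_def by blast
qed

text \<open>The image of \<open>Hub\<close>, \<open>L k\<close>, \<open>R k\<close> is still a
  triangle, and a finite set of natural numbers leaves a fresh vertex.\<close>

lemma shape_imp_nabla_Y_possible:
  fixes G :: "nat pair_pre_digraph"
  assumes "shape b c k G" "k < b" "b \<le> c"
  shows "\<exists>H. nabla_Y G H"
proof -
  from assms(1) obtain f where f: "inj_on f (pverts (T b c k))" "G = map_graph f (T b c k)"
    by (auto simp: shape_def)
  have G: "pair_graph G"
    using assms(1) by (rule shape_pair_graph)
  then obtain v where "v \<notin> pverts G"
    using ex_new_if_finite[of "pverts G"] by (auto simp: pair_graph_iff)
  moreover have "card (f ` {Hub, L k, R k}) = 3"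
  proof (subst card_image)
    show "inj_on f {Hub, L k, R k}"
      using f(1) by (rule inj_on_subset) (use assms(2,3) in auto)
  qed simp
  moreover have "f ` {Hub, L k, R k} \<times> f ` {Hub, L k, R k} - Id \<subseteq> parcs G"
    using assms(2,3) map_graph_arc_iff[OF pair_graph_T f(1)] unfolding f(2) by auto
  ultimately show ?thesis
    using nabla_Y_iff_tri_to_Y[OF G] by blast
qed

lemma cousins_complete_tripartite_iff:
  assumes "5 \<le> b" "b \<le> c"
  shows "cousins (complete_tripartite 1 b c) H \<longleftrightarrow> (\<exists>k\<le>b. shape b c k H)"
proof
  assume "cousins (complete_tripartite 1 b c) H"
  then show "\<exists>k\<le>b. shape b c k H"
    unfolding cousins_def
  proof (induction rule: rtranclp_induct)
    case base
    then show ?case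
      using shape_complete_tripartite by blast
  next
    case (step G H)
    then obtain k where k: "k \<le> b" "shape b c k G"
      by blast
    from step.hyps(2) consider "nabla_Y G H" | "Y_nabla G H" | "graph_iso G H"
      by blast
    then show ?case
    proof cases
      case 1
      then show ?thesis
        using shape_nabla_Y[OF k(2,1) assms(2) 1] by (intro exI[of _ "Suc k"]) auto
    next
      case 2
      obtain k' where "k = Suc k'" "shape b c k' H"
        using 2 by (rule shape_Y_nabla[OF k(2,1) assms])
      then show ?thesis
        using k(1) by (intro exI[of _ k']) auto
    next
      case 3
      then show ?thesis
        using k shape_graph_iso by blast
    qed
  qed
next
  assume "\<exists>k\<le>b. shape b c k H"
  then obtain k where k: "k \<le> b" "shape b c k H"
    by blast
  \<comment> \<open>Triangle-Y moves reach some graph of shape \<open>k\<close>; one isomorphism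
    step then leads from it to the given \<open>H\<close>.\<close>
  from k(1) have "\<exists>G. shape b c k G \<and> cousins (complete_tripartite 1 b c) G"
  proof (induction k)
    case 0
    then show ?case
      using shape_complete_tripartite by (auto simp: cousins_def)
  next
    case (Suc k)
    then obtain G where G: "shape b c k G" "cousins (complete_tripartite 1 b c) G"
      by auto
    with Suc.prems assms(2) obtain G' where G': "nabla_Y G G'"
      using shape_imp_nabla_Y_possible by (metis Suc_le_eq)
    then have "shape b c (Suc k) G'"
      using shape_nabla_Y[OF G(1) _ assms(2)] Suc.prems by auto
    moreover have "cousins (complete_tripartite 1 b c) G'"
      using G(2) G' unfolding cousins_def by (auto intro: rtranclp.rtrancl_into_rtrancl)
    ultimately show ?case by blast
  qed
  then obtain G where G: "shape b c k G" "cousins (complete_tripartite 1 b c) G"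
    by blast
  then have "graph_iso G H"
    using k(2) same_shape_graph_iso by blast
  with G(2) show "cousins (complete_tripartite 1 b c) H"
    unfolding cousins_def by (auto intro: rtranclp.rtrancl_into_rtrancl)
qed

section \<open>Counting the isomorphism classes\<close>

lemma iso_rel_class_shape:
  assumes "shape b c k G"
  shows "iso_rel `` {G} = {H. shape b c k H}"
proof -
  have "(G, H) \<in> iso_rel \<longleftrightarrow> shape b c k H" for H
    unfolding iso_rel_def
    using shape_graph_iso[OF assms] same_shape_graph_iso[OF assms]
      shape_pair_graph[OF assms] shape_pair_graph[of b c k H] by blast
  then show ?thesis by blast
qed

lemma shape_exists: "\<exists>G :: nat pair_pre_digraph. shape b c k G"
proof -
  have "finite (pverts (T b c k))"
    using pair_graph_T by (simp add: pair_graph_iff)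
  then obtain f :: "vtx \<Rightarrow> nat" where "inj_on f (pverts (T b c k))"
    using finite_imp_inj_to_nat_seg by metis
  then show ?thesis
    unfolding shape_def by blast
qed

theorem theorem4:
  fixes b c :: nat
  assumes "6 \<le> b" and "b \<le> c"
  shows "card (family (complete_tripartite 1 b c)) = 1 + b"
proof -
  let ?class = "\<lambda>k. {H :: nat pair_pre_digraph. shape b c k H}"
  have cousins: "{H. cousins (complete_tripartite 1 b c) H} = (\<Union>k\<le>b. ?class k)"
    using cousins_complete_tripartite_iff[of b c] assms by auto
  have "family (complete_tripartite 1 b c) = ?class ` {..b}"
  proof (intro equalityI subsetI)
    fix X assume "X \<in> family (complete_tripartite 1 b c)"
    then obtain G k where "k \<le> b" "shape b c k G" "X = iso_rel `` {G}"
      unfolding family_def cousins by (auto elim!: quotientE)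
    then show "X \<in> ?class ` {..b}"
      using iso_rel_class_shape by blast
  next
    fix X assume "X \<in> ?class ` {..b}"
    then obtain k where k: "k \<le> b" "X = ?class k"
      by blast
    obtain G :: "nat pair_pre_digraph" where G: "shape b c k G"
      using shape_exists by blast
    then have "X = iso_rel `` {G}"
      using k(2) iso_rel_class_shape by blast
    moreover have "G \<in> (\<Union>k\<le>b. ?class k)"
      using G k(1) by blast
    ultimately show "X \<in> family (complete_tripartite 1 b c)"
      unfolding family_def cousins by (auto intro: quotientI)
  qed
  \<comment> \<open>Each class is nonempty, so equal classes share a graph, whose number of vertices
    determines the index.\<close>
  moreover have "inj_on ?class {..b}"
  proof (rule inj_onI)
    fix k l assume eq: "?class k = ?class l"
    obtain G :: "nat pair_pre_digraph" where "shape b c k G"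
      using shape_exists by blast
    with eq have "shape b c k G" "shape b c l G"
      by blast+
    then have "1 + b + c + k = 1 + b + c + l"
      using shape_card_pverts by metis
    then show "k = l"
      by simp
  qed
  ultimately show ?thesis
    by (simp add: card_image)
qed

end
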